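(* For the complete graph $K_n$ with $n \geq 4$, $\mathcal{D}_{\mathrm{lir}}(K_n) = 2$ if $6 \leq n \leq 10$, and $\mathcal{D}_{\mathrm{lir}}(K_n) = 1$ otherwise.
   Context: A (multi)graph is locally irregular if the two endvertices of every edge have different degrees (counting parallel edges with multiplicity). For a graph $G$ and $E_d \subseteq E(G)$, $G + E_d$ is the multigraph obtained by replacing each edge of $E_d$ by two parallel edges. For a connected graph $G$ not isomorphic to $K_2$ or $K_3$, $\mathcal{D}_{\mathrm{lir}}(G)$ is the minimum size of a set $E_d \subseteq E(G)$ such that the edges of $G+E_d$ can be colored with at most two colors so that each color class induces a locally irregular submultigraph and parallel edges receive the same color. *)

theory Defs
  imports "HOL-Library.Extended_Nat"
begin

record ('v, 'e) multigraph =
  verts :: "'v set"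
  edges :: "'e set"
  ends  :: "'e \<Rightarrow> 'v set"

text \<open>All multigraphs below are finite and loopless, so each edge contributes
  at most one to the degree of a vertex.\<close>

definition degree :: "('v, 'e) multigraph \<Rightarrow> 'v \<Rightarrow> nat" where
  "degree M v = card {e \<in> edges M. v \<in> ends M e}"

definition locally_irregular :: "('v, 'e) multigraph \<Rightarrow> bool" where
  "locally_irregular M \<longleftrightarrow>
     (\<forall>e \<in> edges M. \<forall>u v. u \<noteq> v \<and> ends M e = {u, v} \<longrightarrow> degree M u \<noteq> degree M v)"

definition edge_induced :: "('v, 'e) multigraph \<Rightarrow> 'e set \<Rightarrow> ('v, 'e) multigraph" where
  "edge_induced M F = \<lparr>verts = \<Union> (ends M ` F), edges = F, ends = ends M\<rparr>"

text \<open>Colour classes may be empty, so this means at most two colours.\<close>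

definition two_lir_colorable :: "('v, 'e) multigraph \<Rightarrow> bool" where
  "two_lir_colorable M \<longleftrightarrow>
     (\<exists>c :: 'e \<Rightarrow> nat.
        (\<forall>e \<in> edges M. c e < 2) \<and>
        (\<forall>e \<in> edges M. \<forall>f \<in> edges M. ends M e = ends M f \<longrightarrow> c e = c f) \<and>
        (\<forall>i < 2. locally_irregular (edge_induced M {e \<in> edges M. c e = i})))"

record 'v graph =
  gverts :: "'v set"
  gedges :: "'v set set"

text \<open>The flag distinguishes the original copy of an edge from the added parallel one.\<close>

definition double_edges :: "'v graph \<Rightarrow> 'v set set \<Rightarrow> ('v, 'v set \<times> bool) multigraph" where
  "double_edges G Ed =
     \<lparr>verts = gverts G, edges = gedges G \<times> {False} \<union> Ed \<times> {True}, ends = fst\<rparr>"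

text \<open>This is meant for finite connected graphs other than \<open>K\<^sub>2\<close> and \<open>K\<^sub>3\<close>;
  the value is \<open>\<infinity>\<close> if there is no suitable edge set.\<close>

definition D_lir :: "'v graph \<Rightarrow> enat" where
  "D_lir G = (INF Ed \<in> {Ed. Ed \<subseteq> gedges G \<and> two_lir_colorable (double_edges G Ed)}. enat (card Ed))"

definition complete_graph :: "nat \<Rightarrow> nat graph" where
  "complete_graph n =
     \<lparr>gverts = {..<n}, gedges = {{u, v} | u v. u < n \<and> v < n \<and> u \<noteq> v}\<rparr>"

end

(* With a single doubled edge xy, say red, all other vertices must have distinct red degrees in the
   simple graph, since red and blue degrees add up to n - 1 there; without a doubled edge this would
   require n distinct degrees, which no simple graph has.

   Order the p = n - 2 other vertices by degree. Because their degrees are almost consecutive, the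
   Erdos-Gallai count of the edges between the upper and the lower half forces x and y to be adjacent
   to many more vertices above than below. On the other hand, x must be adjacent to the vertex whose
   degree equals its own, and not adjacent to the one whose degree is larger by one, which limits this
   imbalance. For n from 6 to 10 the two requirements and the parity of the degree sum are
   contradictory, by a finite check over degree sequences and neighbourhoods of x and y. For n = 11
   there is a solution, and alternately adding an isolated and a universal vertex gives all larger n. *)

theory Submission
  imports Defs
begin

subsection \<open>Colourings as red graphs\<close>

definition rdeg :: "nat \<Rightarrow> (nat \<Rightarrow> nat \<Rightarrow> bool) \<Rightarrow> nat \<Rightarrow> nat" where
  "rdeg n R v = card {u. u < n \<and> R u v}"

text \<open>A colouring is given by its red edges \<open>R\<close>, and the blue edges are the complement of \<open>R\<close>;
  an edge of \<open>Ed\<close> counts twice.\<close>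

definition cdeg :: "nat \<Rightarrow> nat set set \<Rightarrow> (nat \<Rightarrow> nat \<Rightarrow> bool) \<Rightarrow> nat \<Rightarrow> nat" where
  "cdeg n Ed R v = card {u. u < n \<and> u \<noteq> v \<and> R u v} + card {u. u < n \<and> u \<noteq> v \<and> R u v \<and> {u, v} \<in> Ed}"

definition lir_coloring :: "nat \<Rightarrow> nat set set \<Rightarrow> (nat \<Rightarrow> nat \<Rightarrow> bool) \<Rightarrow> bool" where
  "lir_coloring n Ed R \<longleftrightarrow> (\<forall>u<n. \<forall>v<n. u \<noteq> v \<longrightarrow>
     (R u v \<longleftrightarrow> R v u) \<and>
     (if R u v then cdeg n Ed R u \<noteq> cdeg n Ed R v
      else cdeg n Ed (\<lambda>u v. \<not> R u v) u \<noteq> cdeg n Ed (\<lambda>u v. \<not> R u v) v))"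

section \<open>From colour classes of the multigraph to degrees on vertex numbers\<close>

text \<open>The flag splits the edges of the class at \<open>v\<close> into original and added
  copies. Both parts are injective images of sets of neighbours, and the added copy has the colour
  of its original.\<close>

lemma degree_color_class:
  fixes c :: "nat set \<times> bool \<Rightarrow> nat"
  assumes Ed: "Ed \<subseteq> gedges (complete_graph n)"
    and c: "\<And>e. e \<in> Ed \<Longrightarrow> c (e, True) = c (e, False)"
    and v: "v < n"
  defines "M \<equiv> double_edges (complete_graph n) Ed"
  shows "degree (edge_induced M {e \<in> edges M. c e = i}) v = cdeg n Ed (\<lambda>u v. c ({u, v}, False) = i) v"
proof -
  let ?A = "{u. u < n \<and> u \<noteq> v \<and> c ({u, v}, False) = i}"
  let ?B = "{u. u < n \<and> u \<noteq> v \<and> c ({u, v}, False) = i \<and> {u, v} \<in> Ed}"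
  have edge: "\<exists>u. u < n \<and> u \<noteq> v \<and> e = {u, v}" if "e \<in> gedges (complete_graph n)" "v \<in> e" for e
    using that by (auto simp: complete_graph_def)
  have edge': "{u, v} \<in> gedges (complete_graph n)" if "u < n" "u \<noteq> v" for u
    using that v by (auto simp: complete_graph_def)
  have "{e \<in> {e \<in> edges M. c e = i}. v \<in> fst e} = (\<lambda>u. ({u, v}, False)) ` ?A \<union> (\<lambda>u. ({u, v}, True)) ` ?B"
    (is "?L = ?R")
  proof (rule set_eqI, rule iffI)
    fix e assume e: "e \<in> ?L"
    obtain f b where fb: "e = (f, b)" by (cases e)
    have f: "f \<in> gedges (complete_graph n)" "v \<in> f" "c (f, b) = i" "b \<Longrightarrow> f \<in> Ed"
      using e Ed by (auto simp: fb M_def double_edges_def)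
    obtain u where "u < n" "u \<noteq> v" "f = {u, v}"
      using edge[OF f(1,2)] by blast
    then show "e \<in> ?R"
      using f c by (cases b) (auto simp: fb)
  next
    fix e assume "e \<in> ?R"
    then show "e \<in> ?L"
      using edge' c by (auto simp: M_def double_edges_def)
  qed
  moreover have "card ((\<lambda>u. ({u, v}, False)) ` ?A \<union> (\<lambda>u. ({u, v}, True)) ` ?B) = card ?A + card ?B"
  proof (subst card_Un_disjoint)
    have inj: "inj_on (\<lambda>u. ({u, v}, b)) S" if "v \<notin> S" for S and b :: bool
      using that by (auto simp: inj_on_def doubleton_eq_iff)
    show "card ((\<lambda>u. ({u, v}, False)) ` ?A) + card ((\<lambda>u. ({u, v}, True)) ` ?B) = card ?A + card ?B"
      by (simp add: card_image inj)
  qed auto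
  ultimately show ?thesis
    by (simp add: degree_def edge_induced_def cdeg_def M_def double_edges_def)
qed

lemma cdeg_cong:
  assumes "\<And>u. u < n \<Longrightarrow> u \<noteq> v \<Longrightarrow> R u v \<longleftrightarrow> R' u v"
  shows "cdeg n Ed R v = cdeg n Ed R' v"
  unfolding cdeg_def using assms by (intro arg_cong2[where f = "(+)"] arg_cong[where f = card]) auto

lemma locally_irregular_color_class_iff:
  fixes c :: "nat set \<times> bool \<Rightarrow> nat"
  assumes Ed: "Ed \<subseteq> gedges (complete_graph n)"
    and c: "\<And>e. e \<in> Ed \<Longrightarrow> c (e, True) = c (e, False)"
  defines "M \<equiv> double_edges (complete_graph n) Ed"
  shows "locally_irregular (edge_induced M {e \<in> edges M. c e = i}) \<longleftrightarrow>
    (\<forall>u<n. \<forall>v<n. u \<noteq> v \<longrightarrow> c ({u, v}, False) = i \<longrightarrow>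
      cdeg n Ed (\<lambda>u v. c ({u, v}, False) = i) u \<noteq> cdeg n Ed (\<lambda>u v. c ({u, v}, False) = i) v)"
    (is "?L \<longleftrightarrow> ?R")
proof -
  let ?N = "edge_induced M {e \<in> edges M. c e = i}"
  have deg: "degree ?N v = cdeg n Ed (\<lambda>u v. c ({u, v}, False) = i) v" if "v < n" for v
    unfolding M_def by (intro degree_color_class Ed c that)
  have fst_edge: "fst e \<in> gedges (complete_graph n)" if "e \<in> edges M" for e
    using that Ed by (auto simp: M_def double_edges_def)
  have less: "u < n" "v < n" if "{u, v} \<in> gedges (complete_graph n)" for u v
    using that by (auto simp: complete_graph_def doubleton_eq_iff)
  have col: "c (fst e, False) = c e" if "e \<in> edges M" for e
    using that c by (auto simp: M_def double_edges_def)
  show ?thesis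
  proof
    assume L: ?L
    show ?R
    proof (intro allI impI)
      fix u v assume uv: "u < n" "v < n" "u \<noteq> v" "c ({u, v}, False) = i"
      then have "({u, v}, False) \<in> edges ?N"
        by (auto simp: edge_induced_def M_def double_edges_def complete_graph_def)
      moreover have "ends ?N ({u, v}, False) = {u, v}"
        by (simp add: edge_induced_def M_def double_edges_def)
      ultimately have "degree ?N u \<noteq> degree ?N v"
        using L uv(3) unfolding locally_irregular_def by blast
      then show "cdeg n Ed (\<lambda>u v. c ({u, v}, False) = i) u \<noteq> cdeg n Ed (\<lambda>u v. c ({u, v}, False) = i) v"
        using uv by (simp add: deg)
    qed
  next
    assume R: ?R
    show ?L
      unfolding locally_irregular_def
    proof (intro ballI allI impI)
      fix e u v
      assume e: "e \<in> edges ?N" and uv: "u \<noteq> v \<and> ends ?N e = {u, v}"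
      have eM: "e \<in> edges M" "c e = i" using e by (auto simp: edge_induced_def)
      have fe: "fst e = {u, v}" using uv by (simp add: edge_induced_def M_def double_edges_def)
      have "u < n" "v < n" using less fst_edge[OF eM(1)] fe by auto
      moreover have "c ({u, v}, False) = i" using col[OF eM(1)] eM(2) fe by simp
      ultimately show "degree ?N u \<noteq> degree ?N v"
        using R uv by (simp add: deg)
    qed
  qed
qed

text \<open>From here on multigraphs can be avoided: colour \<open>1\<close> is read as red, and the
  original copies alone determine the colouring.\<close>

lemma two_lir_colorable_double_complete_iff:
  assumes Ed: "Ed \<subseteq> gedges (complete_graph n)"
  shows "two_lir_colorable (double_edges (complete_graph n) Ed) \<longleftrightarrow> (\<exists>R. lir_coloring n Ed R)"
    (is "two_lir_colorable ?M \<longleftrightarrow> _")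
proof
  assume "two_lir_colorable ?M"
  then obtain c where c2: "\<forall>e \<in> edges ?M. c e < 2"
    and cp: "\<forall>e \<in> edges ?M. \<forall>f \<in> edges ?M. ends ?M e = ends ?M f \<longrightarrow> c e = c f"
    and li: "\<forall>i < (2::nat). locally_irregular (edge_induced ?M {e \<in> edges ?M. c e = i})"
    unfolding two_lir_colorable_def by blast
  have c: "c (e, True) = c (e, False)" if "e \<in> Ed" for e
  proof -
    have "(e, True) \<in> edges ?M" "(e, False) \<in> edges ?M"
      using that Ed by (auto simp: double_edges_def)
    then show ?thesis using cp by (auto simp: double_edges_def)
  qed
  have c01: "c ({u, v}, False) = 0 \<or> c ({u, v}, False) = 1" if "u < n" "v < n" "u \<noteq> v" for u v
  proof -
    have "({u, v}, False) \<in> edges ?M" using that by (auto simp: double_edges_def complete_graph_def)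
    then have "c ({u, v}, False) < 2" using c2 by blast
    then show ?thesis by linarith
  qed
  have li': "cdeg n Ed (\<lambda>u v. c ({u, v}, False) = i) u \<noteq> cdeg n Ed (\<lambda>u v. c ({u, v}, False) = i) v"
    if "i < 2" "u < n" "v < n" "u \<noteq> v" "c ({u, v}, False) = i" for i u v
  proof -
    have "locally_irregular (edge_induced ?M {e \<in> edges ?M. c e = i})"
      using li that(1) by blast
    then show ?thesis
      using that by (subst (asm) locally_irregular_color_class_iff[OF Ed]) (auto simp: c)
  qed
  let ?R = "\<lambda>u v. c ({u, v}, False) = 1"
  have blue: "cdeg n Ed (\<lambda>u v. \<not> ?R u v) v = cdeg n Ed (\<lambda>u v. c ({u, v}, False) = 0) v" if "v < n" for v
    using c01[OF _ that] by (intro cdeg_cong) auto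
  have "lir_coloring n Ed ?R"
    unfolding lir_coloring_def
  proof (intro allI impI conjI)
    fix u v assume uv: "u < n" "v < n" "u \<noteq> v"
    show "?R u v \<longleftrightarrow> ?R v u" by (simp add: insert_commute)
    show "if ?R u v then cdeg n Ed ?R u \<noteq> cdeg n Ed ?R v
      else cdeg n Ed (\<lambda>u v. \<not> ?R u v) u \<noteq> cdeg n Ed (\<lambda>u v. \<not> ?R u v) v"
    proof (cases "?R u v")
      case True
      then show ?thesis using li'[of 1] uv by simp
    next
      case False
      then have "c ({u, v}, False) = 0" using c01[OF uv] by simp
      with False show ?thesis using li'[of 0] uv by (simp add: blue[simplified])
    qed
  qed
  then show "\<exists>R. lir_coloring n Ed R" by (intro exI[of _ ?R])
next
  assume "\<exists>R. lir_coloring n Ed R"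
  then obtain R where R: "lir_coloring n Ed R" ..
  \<comment> \<open>\<open>Min\<close> and \<open>Max\<close> turn an edge into an ordered pair of
    endvertices; the symmetry of \<open>R\<close> makes the order immaterial. Ignoring the flag
    gives parallel edges the same colour.\<close>
  define c :: "nat set \<times> bool \<Rightarrow> nat" where "c e = of_bool (R (Min (fst e)) (Max (fst e)))" for e
  have c: "c ({u, v}, b) = of_bool (R u v)" if "u < n" "v < n" "u \<noteq> v" for u v b
    using R that unfolding c_def lir_coloring_def
    by (cases u v rule: linorder_cases) (auto simp: min_def max_def)
  have par: "c (e, True) = c (e, False)" for e by (simp add: c_def)
  have red: "cdeg n Ed (\<lambda>u v. c ({u, v}, False) = 1) v = cdeg n Ed R v"
    and blue: "cdeg n Ed (\<lambda>u v. c ({u, v}, False) = 0) v = cdeg n Ed (\<lambda>u v. \<not> R u v) v" if "v < n" for v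
    using that by (auto intro!: cdeg_cong simp: c of_bool_def split: if_splits)
  note iff = locally_irregular_color_class_iff[OF Ed, of c, OF par]
  have "locally_irregular (edge_induced ?M {e \<in> edges ?M. c e = 0})"
    "locally_irregular (edge_induced ?M {e \<in> edges ?M. c e = 1})"
    using R unfolding iff by (auto simp: c red[simplified] blue lir_coloring_def split: if_splits)
  then have "\<forall>i<2. locally_irregular (edge_induced ?M {e \<in> edges ?M. c e = i})"
    by (auto simp: less_2_cases_iff)
  moreover have "\<forall>e \<in> edges ?M. \<forall>f \<in> edges ?M. ends ?M e = ends ?M f \<longrightarrow> c e = c f"
    by (auto simp: double_edges_def c_def)
  moreover have "\<forall>e \<in> edges ?M. c e < 2" by (simp add: c_def)
  ultimately show "two_lir_colorable ?M" unfolding two_lir_colorable_def by blast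
qed

section \<open>A single doubled edge\<close>

text \<open>Condition for a red graph \<open>R\<close> with \<open>xy\<close> as the only doubled edge, in terms of the simple red
  degrees \<open>r\<close>. Two vertices outside \<open>{x, y}\<close> have complementary degrees \<open>r\<close> and \<open>n - 1 - r\<close>, so they need
  distinct \<open>r\<close> whatever the colour of their edge. A vertex \<open>z \<in> {x, y}\<close> has red degree \<open>r z + 1\<close> but blue
  degree \<open>n - 1 - r z\<close>, which gives the last clause.\<close>

definition good_pair :: "nat \<Rightarrow> (nat \<Rightarrow> nat \<Rightarrow> bool) \<Rightarrow> nat \<Rightarrow> nat \<Rightarrow> bool" where
  "good_pair n R x y \<longleftrightarrow> x < n \<and> y < n \<and> x \<noteq> y \<and> symp R \<and> irreflp R \<and> R x y \<and>
     rdeg n R x \<noteq> rdeg n R y \<and> inj_on (rdeg n R) ({..<n} - {x, y}) \<and>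
     (\<forall>z \<in> {x, y}. \<forall>v \<in> {..<n} - {x, y}. rdeg n R v \<noteq> rdeg n R z + of_bool (R z v))"

lemma rdeg_complement:
  assumes "irreflp R" "v < n"
  shows "card {u. u < n \<and> u \<noteq> v \<and> \<not> R u v} = n - 1 - rdeg n R v" and "rdeg n R v \<le> n - 1"
proof -
  let ?N = "{u. u < n \<and> R u v}"
  have sub: "?N \<subseteq> {..<n} - {v}"
    using assms by (auto simp: irreflp_def)
  have card: "card ({..<n} - {v}) = n - 1" using assms by simp
  have "{u. u < n \<and> u \<noteq> v \<and> \<not> R u v} = ({..<n} - {v}) - ?N"
    by auto
  then show "card {u. u < n \<and> u \<noteq> v \<and> \<not> R u v} = n - 1 - rdeg n R v"
    using card_Diff_subset[OF _ sub] card by (simp add: rdeg_def)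
  show "rdeg n R v \<le> n - 1"
    using card_mono[OF _ sub] card by (simp add: rdeg_def)
qed

lemma lir_coloring_single_iff:
  assumes R: "symp R" "irreflp R" and xy: "x < n" "y < n" "x \<noteq> y" "R x y"
  shows "lir_coloring n {{x, y}} R \<longleftrightarrow> good_pair n R x y"
proof -
  let ?r = "rdeg n R"
  have sym: "R u v \<longleftrightarrow> R v u" for u v using R by (blast dest: sympD)
  have "R y x" using sym xy by blast
  have red: "cdeg n {{x, y}} R v = ?r v + of_bool (v \<in> {x, y})" if "v < n" for v
  proof -
    have "{u. u < n \<and> u \<noteq> v \<and> R u v} = {u. u < n \<and> R u v}"
      using R by (auto simp: irreflp_def)
    moreover have "{u. u < n \<and> u \<noteq> v \<and> R u v \<and> {u, v} \<in> {{x, y}}} =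
        (if v = x then {y} else if v = y then {x} else {})"
      using xy \<open>R y x\<close> by (auto simp: doubleton_eq_iff)
    ultimately show ?thesis by (simp add: cdeg_def rdeg_def)
  qed
  have blue: "cdeg n {{x, y}} (\<lambda>u v. \<not> R u v) v = n - 1 - ?r v" if "v < n" for v
  proof -
    have "{u. u < n \<and> u \<noteq> v \<and> \<not> R u v \<and> {u, v} \<in> {{x, y}}} = {}"
      using xy \<open>R y x\<close> by (auto simp: doubleton_eq_iff)
    then show ?thesis
      unfolding cdeg_def rdeg_complement(1)[OF R(2) that] by (simp only: card.empty)
  qed
  have blue_eq: "n - 1 - ?r u = n - 1 - ?r v \<longleftrightarrow> ?r u = ?r v" if "u < n" "v < n" for u v
    using rdeg_complement(2)[OF R(2) that(1)] rdeg_complement(2)[OF R(2) that(2)] by linarith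
  \<comment> \<open>One inequality covers both colours: the red doubled edge raises only the red
    degrees of \<open>x\<close> and \<open>y\<close>, and blue degrees differ exactly when the
    simple red degrees do.\<close>
  have "(R u v \<longleftrightarrow> R v u) \<and>
      (if R u v then cdeg n {{x, y}} R u \<noteq> cdeg n {{x, y}} R v
       else cdeg n {{x, y}} (\<lambda>u v. \<not> R u v) u \<noteq> cdeg n {{x, y}} (\<lambda>u v. \<not> R u v) v) \<longleftrightarrow>
      ?r u + of_bool (R u v \<and> u \<in> {x, y}) \<noteq> ?r v + of_bool (R u v \<and> v \<in> {x, y})"
    if uv: "u < n" "v < n" for u v
    using sym[of u v] blue_eq[OF uv]
    by (cases "R u v") (simp_all only: red[OF uv(1)] red[OF uv(2)] blue[OF uv(1)] blue[OF uv(2)] simp_thms if_True if_False of_bool_eq add_0_right)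
  then have "lir_coloring n {{x, y}} R \<longleftrightarrow> (\<forall>u<n. \<forall>v<n. u \<noteq> v \<longrightarrow>
      ?r u + of_bool (R u v \<and> u \<in> {x, y}) \<noteq> ?r v + of_bool (R u v \<and> v \<in> {x, y}))"
    unfolding lir_coloring_def by blast
  also have "\<dots> \<longleftrightarrow> good_pair n R x y"
  proof
    assume L: "\<forall>u<n. \<forall>v<n. u \<noteq> v \<longrightarrow>
      ?r u + of_bool (R u v \<and> u \<in> {x, y}) \<noteq> ?r v + of_bool (R u v \<and> v \<in> {x, y})"
    have "?r x \<noteq> ?r y" using L[rule_format, of x y] xy by simp
    moreover have "inj_on ?r ({..<n} - {x, y})"
    proof (rule inj_onI, rule ccontr)
      fix u v assume "u \<in> {..<n} - {x, y}" "v \<in> {..<n} - {x, y}" "?r u = ?r v" "u \<noteq> v"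
      then show False using L[rule_format, of u v] by simp
    qed
    moreover have "?r v \<noteq> ?r z + of_bool (R z v)" if "z \<in> {x, y}" "v \<in> {..<n} - {x, y}" for z v
      using L[rule_format, of z v] that xy by auto
    ultimately show "good_pair n R x y"
      using R xy unfolding good_pair_def by blast
  next
    assume G: "good_pair n R x y"
    show "\<forall>u<n. \<forall>v<n. u \<noteq> v \<longrightarrow>
      ?r u + of_bool (R u v \<and> u \<in> {x, y}) \<noteq> ?r v + of_bool (R u v \<and> v \<in> {x, y})"
    proof (intro allI impI)
      fix u v assume uv: "u < n" "v < n" "u \<noteq> v"
      have inj: "inj_on ?r ({..<n} - {x, y})" and ne: "?r x \<noteq> ?r y"
        and z: "\<And>z v. z \<in> {x, y} \<Longrightarrow> v \<in> {..<n} - {x, y} \<Longrightarrow> ?r v \<noteq> ?r z + of_bool (R z v)"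
        using G unfolding good_pair_def by blast+
      consider "u \<in> {x, y}" "v \<in> {x, y}" | "u \<in> {x, y}" "v \<notin> {x, y}"
        | "u \<notin> {x, y}" "v \<in> {x, y}" | "u \<notin> {x, y}" "v \<notin> {x, y}" by blast
      then show "?r u + of_bool (R u v \<and> u \<in> {x, y}) \<noteq> ?r v + of_bool (R u v \<and> v \<in> {x, y})"
      proof cases
        case 1
        then show ?thesis using ne uv by auto
      next
        case 2
        then show ?thesis using z[of u v] uv by simp
      next
        case 3
        then show ?thesis using z[of v u] uv sym[of u v] by auto
      next
        case 4
        then show ?thesis using inj_onD[OF inj, of u v] uv by auto
      qed
    qed
  qed
  finally show ?thesis .
qed

lemma lir_coloring_complement:
  "lir_coloring n Ed R \<Longrightarrow> lir_coloring n Ed (\<lambda>u v. \<not> R u v)"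
  unfolding lir_coloring_def by simp

text \<open>A colouring says nothing about \<open>R\<close> on the diagonal or beyond
  \<open>n\<close>. Erasing \<open>R\<close> there makes it symmetric and irreflexive
  everywhere.\<close>

lemma lir_coloring_normalize:
  assumes "lir_coloring n Ed R"
  obtains R' where "symp R'" "irreflp R'" "lir_coloring n Ed R'"
    "\<And>u v. u < n \<Longrightarrow> v < n \<Longrightarrow> u \<noteq> v \<Longrightarrow> R' u v \<longleftrightarrow> R u v"
proof
  define R' where "R' u v \<longleftrightarrow> u < n \<and> v < n \<and> u \<noteq> v \<and> R u v" for u v
  show "symp R'"
    using assms unfolding symp_def R'_def lir_coloring_def by blast
  show "irreflp R'" by (simp add: irreflp_def R'_def)
  show eq: "R' u v \<longleftrightarrow> R u v" if "u < n" "v < n" "u \<noteq> v" for u v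
    using that by (simp add: R'_def)
  have "cdeg n Ed R' v = cdeg n Ed R v"
    "cdeg n Ed (\<lambda>u v. \<not> R' u v) v = cdeg n Ed (\<lambda>u v. \<not> R u v) v" if "v < n" for v
    using that by (auto intro!: cdeg_cong simp: R'_def)
  then show "lir_coloring n Ed R'"
    using assms eq unfolding lir_coloring_def by (metis (no_types, lifting))
qed

lemma good_pair_if_lir_coloring:
  assumes "lir_coloring n {{x, y}} R" and xy: "x < n" "y < n" "x \<noteq> y"
  shows "\<exists>R. good_pair n R x y"
proof -
  \<comment> \<open>The colours are swapped if necessary, so that the doubled edge is red.\<close>
  obtain R where R: "lir_coloring n {{x, y}} R" "R x y"
    using assms(1) lir_coloring_complement[OF assms(1)] by blast
  then obtain R' where "symp R'" "irreflp R'" "lir_coloring n {{x, y}} R'" "R' x y"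
    using lir_coloring_normalize[OF R(1)] xy by metis
  then show ?thesis using lir_coloring_single_iff xy by blast
qed

subsection \<open>Extension by isolated and universal vertices\<close>

definition extend :: "nat \<Rightarrow> bool \<Rightarrow> (nat \<Rightarrow> nat \<Rightarrow> bool) \<Rightarrow> nat \<Rightarrow> nat \<Rightarrow> bool" where
  "extend n b R u v \<longleftrightarrow> (if u = n \<or> v = n then b \<and> u \<noteq> v else R u v)"

lemma rdeg_extend:
  shows "v < n \<Longrightarrow> rdeg (Suc n) (extend n b R) v = rdeg n R v + of_bool b"
    and "rdeg (Suc n) (extend n b R) n = (if b then n else 0)"
proof -
  assume v: "v < n"
  have "{u. u < Suc n \<and> extend n b R u v} = {u. u < n \<and> R u v} \<union> (if b then {n} else {})"
    using v by (auto simp: extend_def less_Suc_eq)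
  then show "rdeg (Suc n) (extend n b R) v = rdeg n R v + of_bool b"
    by (simp add: rdeg_def)
next
  have "{u. u < Suc n \<and> extend n b R u n} = (if b then {..<n} else {})"
    by (auto simp: extend_def less_Suc_eq)
  then show "rdeg (Suc n) (extend n b R) n = (if b then n else 0)"
    by (simp add: rdeg_def)
qed

lemma good_pair_rdeg_pos:
  assumes "good_pair n R x y"
  shows "0 < rdeg n R x" "0 < rdeg n R y"
  using assms by (auto simp: good_pair_def rdeg_def card_gt_0_iff dest: sympD)

text \<open>All old degrees shift by the same amount, so only conflicts with the new vertex matter.
  \<open>W\<close> keeps its degree off those of the vertices outside \<open>{x, y}\<close>. A
  universal vertex clashes with \<open>x\<close> or \<open>y\<close> only at degree
  \<open>n - 2\<close>, and an isolated one never does, since \<open>x\<close> and \<open>y\<close>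
  have positive degree.\<close>

lemma good_pair_extend:
  assumes G: "good_pair n R x y"
    and W: "\<And>v. v < n \<Longrightarrow> v \<noteq> x \<Longrightarrow> v \<noteq> y \<Longrightarrow> rdeg n R v + of_bool b \<noteq> (if b then n else 0)"
    and xy: "b \<Longrightarrow> rdeg n R x + 2 \<noteq> n" "b \<Longrightarrow> rdeg n R y + 2 \<noteq> n"
  shows "good_pair (Suc n) (extend n b R) x y"
proof -
  let ?r = "rdeg (Suc n) (extend n b R)"
  have S: "symp R" "irreflp R" "x < n" "y < n" "x \<noteq> y" "R x y"
    and inj: "inj_on (rdeg n R) ({..<n} - {x, y})" and ne: "rdeg n R x \<noteq> rdeg n R y"
    and z: "\<And>z v. z \<in> {x, y} \<Longrightarrow> v \<in> {..<n} - {x, y} \<Longrightarrow> rdeg n R v \<noteq> rdeg n R z + of_bool (R z v)"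
    using G unfolding good_pair_def by blast+
  have ext: "{..<Suc n} - {x, y} = insert n ({..<n} - {x, y})"
    using S by auto
  have "symp (extend n b R)"
  proof (rule sympI)
    fix u v assume "extend n b R u v"
    then show "extend n b R v u"
      using sympD[OF S(1), of u v] by (auto simp: extend_def split: if_splits)
  qed
  moreover have "irreflp (extend n b R)"
    using S(2) by (simp add: extend_def irreflp_def)
  moreover have "extend n b R x y" using S by (simp add: extend_def)
  moreover have "?r x \<noteq> ?r y" using S ne by (simp add: rdeg_extend)
  moreover have "inj_on ?r ({..<Suc n} - {x, y})"
  proof -
    have "inj_on ?r ({..<n} - {x, y})"
    proof (rule inj_onI)
      fix u v assume "u \<in> {..<n} - {x, y}" "v \<in> {..<n} - {x, y}" "?r u = ?r v"
      then show "u = v" using inj_onD[OF inj, of u v] by (simp add: rdeg_extend(1))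
    qed
    moreover have "?r n \<notin> ?r ` ({..<n} - {x, y})"
    proof
      assume "?r n \<in> ?r ` ({..<n} - {x, y})"
      then obtain v where "v < n" "v \<noteq> x" "v \<noteq> y" "?r n = ?r v" by blast
      then show False using W[of v] by (simp add: rdeg_extend)
    qed
    ultimately show ?thesis unfolding ext by simp
  qed
  moreover have "?r v \<noteq> ?r z' + of_bool (extend n b R z' v)"
    if "z' \<in> {x, y}" "v \<in> {..<Suc n} - {x, y}" for z' v
  proof (cases "v = n")
    case True
    have "z' < n" using that S by auto
    moreover have "0 < rdeg n R z'" "b \<Longrightarrow> rdeg n R z' + 2 \<noteq> n"
      using that good_pair_rdeg_pos[OF G] xy by auto
    ultimately show ?thesis
      using True by (cases b) (simp_all add: rdeg_extend extend_def)
  next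
    case False
    then have "v < n" "z' < n" using that S by auto
    moreover have "rdeg n R v \<noteq> rdeg n R z' + of_bool (R z' v)"
      using z[of z' v] that \<open>v < n\<close> by blast
    ultimately show ?thesis by (simp add: rdeg_extend extend_def)
  qed
  ultimately show ?thesis
    unfolding good_pair_def using less_SucI[OF S(3)] less_SucI[OF S(4)] S(5) by blast
qed

text \<open>Adding an isolated vertex and then a universal one keeps a good pair good. The isolated vertex
  must come first: it makes room above the degrees of \<open>x\<close> and \<open>y\<close>.\<close>

lemma good_pair_extend_twice:
  assumes G: "good_pair n R x y" and pos: "\<forall>v<n. 0 < rdeg n R v"
    and xy: "rdeg n R x + 1 < n" "rdeg n R y + 1 < n"
  shows "good_pair (n + 1) (extend n False R) x y"
    and "\<exists>R. good_pair (n + 2) R x y \<and> (\<forall>v<n+2. 0 < rdeg (n + 2) R v) \<and>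
      rdeg (n + 2) R x + 1 < n + 2 \<and> rdeg (n + 2) R y + 1 < n + 2"
proof -
  let ?R = "extend n False R"
  have n: "x < n" "y < n" "irreflp R" using G by (auto simp: good_pair_def)
  have less: "rdeg n R v < n" if "v < n" for v
    using rdeg_complement(2)[OF n(3) that] that by linarith
  have G': "good_pair (Suc n) ?R x y"
    by (rule good_pair_extend[OF G]) (use pos in auto)
  then show "good_pair (n + 1) ?R x y" by simp
  have r: "rdeg (Suc n) ?R v = (if v = n then 0 else rdeg n R v)" if "v < Suc n" for v
    using that by (auto simp: rdeg_extend)
  have "good_pair (Suc (Suc n)) (extend (Suc n) True ?R) x y"
  proof (rule good_pair_extend[OF G'])
    fix v assume "v < Suc n"
    then show "rdeg (Suc n) ?R v + of_bool True \<noteq> (if True then Suc n else 0)"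
      using less[of v] n by (auto simp: r)
  qed (use n xy in \<open>auto simp: r\<close>)
  moreover have "rdeg (Suc (Suc n)) (extend (Suc n) True ?R) v =
      (if v = Suc n then Suc n else if v = n then 1 else rdeg n R v + 1)" if "v < Suc (Suc n)" for v
  proof (cases "v = Suc n")
    case True
    then show ?thesis by (simp add: rdeg_extend)
  next
    case False
    then have "v < Suc n" using that by simp
    then show ?thesis by (auto simp: rdeg_extend(1) r)
  qed
  ultimately show "\<exists>R. good_pair (n + 2) R x y \<and> (\<forall>v<n+2. 0 < rdeg (n + 2) R v) \<and>
      rdeg (n + 2) R x + 1 < n + 2 \<and> rdeg (n + 2) R y + 1 < n + 2"
    using n xy by (intro exI[of _ "extend (Suc n) True ?R"]) auto
qed

text \<open>The side conditions are restored only after both an isolated and a universal vertex have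
  been added, so the induction advances by two; an odd difference ends with one more isolated
  vertex.\<close>

lemma good_pair_extend_all:
  assumes G: "good_pair n R x y" and pos: "\<forall>v<n. 0 < rdeg n R v"
    and xy: "rdeg n R x + 1 < n" "rdeg n R y + 1 < n" and "n \<le> m"
  shows "\<exists>R. good_pair m R x y"
proof -
  have step: "\<exists>R. good_pair (n + 2 * k) R x y \<and> (\<forall>v<n + 2 * k. 0 < rdeg (n + 2 * k) R v) \<and>
      rdeg (n + 2 * k) R x + 1 < n + 2 * k \<and> rdeg (n + 2 * k) R y + 1 < n + 2 * k" for k
  proof (induction k)
    case 0
    show ?case using G pos xy by auto
  next
    case (Suc k)
    have "n + 2 * Suc k = n + 2 * k + 2" by simp
    then show ?case using Suc.IH good_pair_extend_twice(2) by metis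
  qed
  obtain k where "m = n + 2 * k \<or> m = n + 2 * k + 1"
  proof
    show "m = n + 2 * ((m - n) div 2) \<or> m = n + 2 * ((m - n) div 2) + 1"
      using \<open>n \<le> m\<close> by presburger
  qed
  then show ?thesis
    using step[of k] good_pair_extend_twice(1)[of "n + 2 * k" _ x y] by blast
qed

subsection \<open>Explicit colourings\<close>

definition graph_of :: "(nat \<times> nat) list \<Rightarrow> nat \<Rightarrow> nat \<Rightarrow> bool" where
  "graph_of es u v \<longleftrightarrow> (u, v) \<in> set es \<or> (v, u) \<in> set es"

lemma card_less_eq_length_filter: "card {u. u < n \<and> P u} = length (filter P [0..<n])"
proof -
  have "{u. u < n \<and> P u} = set (filter P [0..<n])" by auto
  then show ?thesis by (metis distinct_card distinct_filter distinct_upt)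
qed

lemma rdeg_code [code]: "rdeg n R v = length (filter (\<lambda>u. R u v) [0..<n])"
  unfolding rdeg_def by (rule card_less_eq_length_filter)

lemma cdeg_code [code]: "cdeg n Ed R v = length (filter (\<lambda>u. u \<noteq> v \<and> R u v) [0..<n]) +
    length (filter (\<lambda>u. u \<noteq> v \<and> R u v \<and> {u, v} \<in> Ed) [0..<n])"
  unfolding cdeg_def by (simp only: card_less_eq_length_filter)

text \<open>The red and blue degrees enter as lists \<open>r\<close> and \<open>b\<close>, so that
  evaluation need not recompute them for every pair of vertices.\<close>

definition separated :: "nat \<Rightarrow> (nat \<Rightarrow> nat \<Rightarrow> bool) \<Rightarrow> nat list \<Rightarrow> nat list \<Rightarrow> bool" where
  "separated n R r b \<longleftrightarrow> list_all (\<lambda>u. list_all (\<lambda>v. u \<noteq> v \<longrightarrow> (R u v \<longleftrightarrow> R v u) \<and>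
     (if R u v then r ! u \<noteq> r ! v else b ! u \<noteq> b ! v)) [0..<n]) [0..<n]"

lemma lir_coloring_code [code]: "lir_coloring n Ed R \<longleftrightarrow>
    separated n R (map (cdeg n Ed R) [0..<n]) (map (cdeg n Ed (\<lambda>u v. \<not> R u v)) [0..<n])"
proof -
  let ?B = "\<lambda>u v. \<not> R u v"
  have nth: "map f [0..<n] ! u = f u" if "u \<in> {0..<n}" for f :: "nat \<Rightarrow> nat" and u
    using that by simp
  have "lir_coloring n Ed R \<longleftrightarrow> (\<forall>u\<in>{0..<n}. \<forall>v\<in>{0..<n}. u \<noteq> v \<longrightarrow> (R u v \<longleftrightarrow> R v u) \<and>
      (if R u v then cdeg n Ed R u \<noteq> cdeg n Ed R v else cdeg n Ed ?B u \<noteq> cdeg n Ed ?B v))"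
    unfolding lir_coloring_def Ball_def atLeastLessThan_iff by (simp only: le0 simp_thms)
  also have "\<dots> \<longleftrightarrow> separated n R (map (cdeg n Ed R) [0..<n]) (map (cdeg n Ed ?B) [0..<n])"
    unfolding separated_def list_all_iff set_upt by (intro ball_cong refl) (simp only: nth)
  finally show ?thesis .
qed

lemma lir_coloring_4: "lir_coloring 4 {{2, 3}} (graph_of [(0, 3), (1, 2), (1, 3), (2, 3)])"
  by code_simp

text \<open>This is the colouring for four vertices with labels shifted by one and an isolated
  vertex \<open>0\<close> added. A universal vertex cannot follow, because vertex \<open>4\<close>
  has red degree \<open>3 = 5 - 2\<close>.\<close>

lemma lir_coloring_5: "lir_coloring 5 {{3, 4}} (graph_of [(1, 4), (2, 3), (2, 4), (3, 4)])"
  by code_simp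

text \<open>In this witness and the next four, the two doubled edges are disjoint, one red and one
  blue.\<close>

lemma lir_coloring_6: "lir_coloring 6 {{3, 4}, {1, 5}}
  (graph_of [(0, 2), (0, 3), (1, 3), (2, 3), (1, 4), (2, 4), (3, 4), (3, 5)])"
  by code_simp

lemma lir_coloring_7: "lir_coloring 7 {{1, 5}, {0, 4}}
  (graph_of [(2, 3), (3, 4), (0, 5), (1, 5), (2, 5), (3, 5), (1, 6), (2, 6), (3, 6), (4, 6), (5, 6)])"
  by code_simp

lemma lir_coloring_8: "lir_coloring 8 {{0, 6}, {1, 2}}
  (graph_of [(1, 2), (0, 3), (2, 3), (1, 4), (0, 5), (3, 5), (4, 5), (2, 6), (5, 6), (1, 7),
    (2, 7), (3, 7), (4, 7), (5, 7), (6, 7)])"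
  by code_simp

lemma lir_coloring_9: "lir_coloring 9 {{1, 2}, {5, 8}}
  (graph_of [(0, 5), (3, 5), (4, 5), (2, 6), (3, 6), (5, 6), (0, 7), (2, 7), (3, 7), (4, 7),
    (5, 7), (6, 7), (1, 8), (3, 8), (4, 8), (5, 8), (6, 8)])"
  by code_simp

lemma lir_coloring_10: "lir_coloring 10 {{4, 5}, {2, 7}}
  (graph_of [(1, 2), (0, 3), (2, 3), (0, 4), (3, 4), (0, 5), (0, 6), (5, 6), (0, 7), (2, 7),
    (3, 7), (5, 7), (6, 7), (2, 8), (5, 8), (7, 8), (0, 9), (2, 9), (3, 9), (4, 9), (5, 9), (7, 9),
    (8, 9)])"
  by code_simp

text \<open>Here the doubled edge joins 9 and 10, and the other vertices have the degrees 1 to 9. The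
  adjacencies to 9 and 10 satisfy the inequalities used for the lower bound, and the remaining edges
  realise the residual degrees by the Havel-Hakimi algorithm.\<close>

definition graph_11 :: "nat \<Rightarrow> nat \<Rightarrow> bool" where
  "graph_11 = graph_of [(0, 6), (1, 6), (1, 8), (2, 5), (2, 7), (2, 8), (3, 5), (3, 7), (3, 8),
    (3, 9), (4, 5), (4, 6), (4, 7), (4, 8), (4, 10), (5, 6), (5, 7), (5, 8), (6, 7), (6, 8),
    (6, 10), (7, 8), (7, 9), (7, 10), (8, 9), (8, 10), (9, 10)]"

lemma lir_coloring_11: "lir_coloring 11 {{9, 10}} graph_11"
  by code_simp

text \<open>These values supply the side conditions for extending the graph: all degrees are
  positive, and those of \<open>9\<close> and \<open>10\<close> are small.\<close>

lemma rdeg_graph_11: "map (rdeg 11 graph_11) [0..<11] = [1, 2, 3, 4, 5, 6, 7, 8, 9, 4, 5]"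
  by code_simp

subsection \<open>Nonexistence for 6 to 10 vertices\<close>

text \<open>In the next definitions, \<open>ds\<close> lists the red degrees of the vertices other than \<open>x\<close> and \<open>y\<close> in
  increasing order, and \<open>X\<close> is the 0/1 list of their adjacencies to \<open>x\<close> (or to \<open>y\<close>), so that
  \<open>sum_list X + 1\<close> is the red degree of \<open>x\<close>.\<close>

definition fits :: "nat list \<Rightarrow> nat list \<Rightarrow> bool" where
  "fits ds X \<longleftrightarrow> list_all2 (\<lambda>d b. d \<noteq> sum_list X + 1 + b) ds X"

text \<open>For an adjacency list this is the surplus of neighbours among the \<open>t\<close>
  vertices of largest degree over those among the \<open>s\<close> of smallest degree. It is also
  applied to the degree list itself.\<close>

definition gain :: "nat \<Rightarrow> nat \<Rightarrow> nat list \<Rightarrow> int" where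
  "gain t s X = int (sum_list (drop (length X - t) X)) - int (sum_list (take s X))"

text \<open>The amount by which \<open>ds\<close> breaks the Erdos-Gallai type bound for the graph
  without \<open>x\<close> and \<open>y\<close>; the edges to \<open>x\<close> and \<open>y\<close>
  have to make up for it.\<close>

definition excess :: "nat \<Rightarrow> nat \<Rightarrow> nat list \<Rightarrow> int" where
  "excess t s ds = gain t s ds - int (t * (t - 1) + t * (length ds - t - s))"

text \<open>Only three numbers per adjacency list matter, so \<open>remdups\<close> shrinks the
  candidates before pairs are formed. The edges at \<open>x\<close> and \<open>y\<close> satisfying
  both inequalities must then violate the parity of the degree sum.\<close>

definition obstructed :: "nat \<Rightarrow> nat \<Rightarrow> nat \<Rightarrow> nat \<Rightarrow> nat list \<Rightarrow> bool" where
  "obstructed t s t' s' ds \<longleftrightarrow>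
     (let P = remdups (map (\<lambda>X. (sum_list X, gain t s X, gain t' s' X))
            (filter (fits ds) (List.n_lists (length ds) [0, 1])));
        k = excess t s ds; k' = excess t' s' ds; m = sum_list ds
      in \<forall>(a, b, c) \<in> set P. \<forall>(a', b', c') \<in> set P.
        a < a' \<longrightarrow> k \<le> b + b' \<longrightarrow> k' \<le> c + c' \<longrightarrow> odd (m + a + a'))"

lemma obstructedD:
  assumes "obstructed t s t' s' ds"
    and "X \<in> set (List.n_lists (length ds) [0, 1])" "fits ds X"
    and "Y \<in> set (List.n_lists (length ds) [0, 1])" "fits ds Y"
    and "sum_list X < sum_list Y" "excess t s ds \<le> gain t s X + gain t s Y"
    and "excess t' s' ds \<le> gain t' s' X + gain t' s' Y"
  shows "odd (sum_list ds + sum_list X + sum_list Y)"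
proof -
  let ?p = "\<lambda>X. (sum_list X, gain t s X, gain t' s' X)"
  let ?C = "{X \<in> set (List.n_lists (length ds) [0, 1]). fits ds X}"
  have "?p X \<in> ?p ` ?C" "?p Y \<in> ?p ` ?C" using assms(2-5) by blast+
  then show ?thesis
    using assms(1,6-8) unfolding obstructed_def Let_def set_remdups set_map set_filter by blast
qed

text \<open>The \<open>p\<close> distinct degrees avoid \<open>0\<close> or avoid \<open>p + 1\<close>, hence they are all but one of \<open>{0..p}\<close> or
  all but one of \<open>{1..p + 1}\<close>.\<close>

definition all_obstructed :: "nat \<Rightarrow> nat \<Rightarrow> nat \<Rightarrow> nat \<Rightarrow> nat \<Rightarrow> bool" where
  "all_obstructed p t s t' s' \<longleftrightarrow> (\<forall>k \<in> set [0..<Suc p].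
     obstructed t s t' s' (filter (\<lambda>i. i \<noteq> k) [0..<Suc p]) \<and>
     obstructed t s t' s' (filter (\<lambda>i. i \<noteq> Suc k) [1..<Suc (Suc p)]))"

section \<open>Parity and edge counting\<close>

text \<open>The handshake lemma: each inserted vertex adds its degree twice, once in its own sum and
  once in those of its neighbours.\<close>

lemma even_sum_degrees:
  fixes R :: "'a \<Rightarrow> 'a \<Rightarrow> bool"
  assumes "finite S" "symp R" "irreflp R"
  shows "even (\<Sum>v\<in>S. \<Sum>u\<in>S. of_bool (R u v) :: nat)"
  using assms(1)
proof induction
  case (insert a S)
  have "(\<Sum>v\<in>insert a S. \<Sum>u\<in>insert a S. of_bool (R u v) :: nat) =
      (\<Sum>u\<in>S. of_bool (R u a)) + (\<Sum>v\<in>S. of_bool (R a v)) + (\<Sum>v\<in>S. \<Sum>u\<in>S. of_bool (R u v))"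
    using insert.hyps assms(3) by (simp add: sum.distrib irreflp_def del: sum_of_bool_eq)
  also have "(\<Sum>v\<in>S. of_bool (R a v) :: nat) = (\<Sum>u\<in>S. of_bool (R u a))"
    using assms(2) by (intro sum.cong refl arg_cong[where f = of_bool]) (blast dest: sympD)
  finally show ?case using insert.IH by simp
qed simp

text \<open>An inequality of Erdos-Gallai type: edges leaving \<open>T\<close> end in \<open>T\<close>, in \<open>B\<close>, or elsewhere, and those
  ending in \<open>B\<close> are paid for by the degrees in \<open>B\<close>.\<close>

lemma sum_degrees_top_le_bottom:
  fixes R :: "'a \<Rightarrow> 'a \<Rightarrow> bool"
  defines "d \<equiv> \<lambda>W v. \<Sum>u\<in>W. of_bool (R u v) :: nat"
  assumes R: "symp R" "irreflp R"
    and W: "finite W" "T \<subseteq> W" "B \<subseteq> W" "T \<inter> B = {}"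
  shows "(\<Sum>v\<in>T. d W v) \<le> (\<Sum>v\<in>B. d W v) +
    (card T * (card T - 1) + card T * (card W - card T - card B))"
proof -
  have fin: "finite T" "finite B" using W finite_subset by blast+
  let ?M = "W - T - B"
  have "d W v = d T v + d ?M v + d B v" for v
  proof -
    have "W = T \<union> (?M \<union> B)" using W by blast
    then have "d W v = d (T \<union> (?M \<union> B)) v" by simp
    also have "\<dots> = d T v + d (?M \<union> B) v"
      unfolding d_def using W fin by (intro sum.union_disjoint) auto
    also have "d (?M \<union> B) v = d ?M v + d B v"
      unfolding d_def using W fin by (intro sum.union_disjoint) auto
    finally show ?thesis by simp
  qed
  then have "(\<Sum>v\<in>T. d W v) = (\<Sum>v\<in>T. d T v) + (\<Sum>v\<in>T. d ?M v) + (\<Sum>v\<in>T. d B v)"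
    by (simp add: sum.distrib)
  moreover have "(\<Sum>v\<in>T. d T v) \<le> card T * (card T - 1)"
  proof -
    have "d T v \<le> card T - 1" if "v \<in> T" for v
    proof -
      have "d T v = d (T - {v}) v"
        unfolding d_def using R(2) that fin by (simp add: sum.remove irreflp_def del: sum_of_bool_eq)
      also have "\<dots> \<le> (\<Sum>u\<in>T - {v}. 1)" unfolding d_def by (intro sum_mono) simp
      finally show ?thesis using that by simp
    qed
    then show ?thesis using sum_bounded_above[of T "d T" "card T - 1"] by simp
  qed
  moreover have "(\<Sum>v\<in>T. d ?M v) \<le> card T * (card W - card T - card B)"
  proof -
    have "card ?M = card W - card T - card B"
    proof -
      have "card ?M = card W - card (T \<union> B)"
        using W fin by (subst card_Diff_subset[symmetric]) (simp_all add: Diff_eq Int_assoc)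
      then show ?thesis using W fin by (simp add: card_Un_disjoint)
    qed
    moreover have "d ?M v \<le> (\<Sum>u\<in>?M. 1)" for v unfolding d_def by (intro sum_mono) simp
    ultimately show ?thesis using sum_bounded_above[of T "d ?M" "card ?M"] by simp
  qed
  moreover have "(\<Sum>v\<in>T. d B v) \<le> (\<Sum>v\<in>B. d W v)"
  proof -
    \<comment> \<open>The edges between \<open>T\<close> and \<open>B\<close> are counted from
      either side.\<close>
    have "(\<Sum>v\<in>T. d B v) = (\<Sum>v\<in>B. d T v)"
      unfolding d_def using R(1)
      by (subst sum.swap) (intro sum.cong refl arg_cong[where f = of_bool], blast dest: sympD)
    also have "\<dots> \<le> (\<Sum>v\<in>B. d W v)"
      unfolding d_def using W by (intro sum_mono sum_mono2) auto
    finally show ?thesis .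
  qed
  ultimately show ?thesis by linarith
qed

lemma rdeg_eq_sum: "rdeg n R v = (\<Sum>u<n. of_bool (R u v))"
proof -
  have "{u. u < n \<and> R u v} = {..<n} \<inter> {u. R u v}" by auto
  then show ?thesis by (simp add: rdeg_def)
qed

lemma sum_lessThan_split_pair:
  fixes f :: "nat \<Rightarrow> nat"
  assumes "x < n" "y < n" "x \<noteq> y"
  shows "(\<Sum>u<n. f u) = (\<Sum>u\<in>{..<n} - {x, y}. f u) + f x + f y"
proof -
  have "(\<Sum>u<n. f u) = f x + (\<Sum>u\<in>{..<n} - {x}. f u)"
    using assms by (intro sum.remove) auto
  also have "(\<Sum>u\<in>{..<n} - {x}. f u) = f y + (\<Sum>u\<in>{..<n} - {x} - {y}. f u)"
    using assms by (intro sum.remove) auto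
  also have "{..<n} - {x} - {y} = {..<n} - {x, y}" by blast
  finally show ?thesis by simp
qed

text \<open>A universal vertex is adjacent to every other vertex, so the two can only
  coincide.\<close>

lemma not_isolated_and_universal:
  assumes "symp R" "irreflp R" "u < n" "v < n" "rdeg n R u = 0" "rdeg n R v = n - 1"
  shows "n = 1"
proof (rule ccontr)
  assume "n \<noteq> 1"
  then have "u \<noteq> v" using assms by auto
  have "{w. w < n \<and> R w v} \<subseteq> {..<n} - {v}" using assms(2) by (auto simp: irreflp_def)
  moreover have "card {w. w < n \<and> R w v} = card ({..<n} - {v})"
    using assms(4,6) by (simp add: rdeg_def)
  ultimately have "{w. w < n \<and> R w v} = {..<n} - {v}" by (intro card_subset_eq) auto
  then have "R u v" using \<open>u \<noteq> v\<close> assms(3) by blast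
  then have "v \<in> {w. w < n \<and> R w u}" using assms(1,4) by (blast dest: sympD)
  then show False using assms(5) by (auto simp: rdeg_def)
qed

lemma card_eq_imp_diff_singleton:
  assumes "S \<subseteq> T" "finite T" "card T = Suc (card S)"
  obtains k where "k \<in> T" "S = T - {k}"
proof -
  have "card (T - S) = 1" using assms by (simp add: card_Diff_subset finite_subset)
  then obtain k where "T - S = {k}" by (auto simp: card_1_singleton_iff)
  then have "k \<in> T" "S = T - {k}" using assms(1) by blast+
  then show thesis by (rule that)
qed

lemma strict_sorted_eqI:
  assumes "sorted ds" "distinct ds" "set ds = {a..<b} - {k}"
  shows "ds = filter (\<lambda>i. i \<noteq> k) [a..<b]"
proof (rule sorted_distinct_set_unique)
  show "sorted (filter (\<lambda>i. i \<noteq> k) [a..<b])" by (intro sorted_wrt_filter) simp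
  show "set ds = set (filter (\<lambda>i. i \<noteq> k) [a..<b])" unfolding assms(3) by auto
qed (use assms in simp_all)

text \<open>Sorting the vertices outside \<open>{x, y}\<close> by red degree yields an instance of
  the finite check. The good pair makes both adjacency lists fit, edge counting between the last
  \<open>t\<close> and the first \<open>s\<close> vertices gives each inequality, and the handshake
  lemma contradicts the parity. The bounds by \<open>p\<close> keep the two blocks disjoint.\<close>

lemma no_good_pair_if_all_obstructed:
  assumes obs: "all_obstructed p t s t' s'" and ts: "t + s \<le> p" "t' + s' \<le> p"
    and n: "n = p + 2" and G: "good_pair n R x y" and less: "rdeg n R x < rdeg n R y"
  shows False
proof -
  let ?r = "rdeg n R" and ?W = "{..<n} - {x, y}"
  have R: "symp R" "irreflp R" and xy: "x < n" "y < n" "x \<noteq> y" "R x y"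
    and inj: "inj_on ?r ?W"
    and z: "\<And>z v. z \<in> {x, y} \<Longrightarrow> v \<in> ?W \<Longrightarrow> ?r v \<noteq> ?r z + of_bool (R z v)"
    using G unfolding good_pair_def by blast+
  have "R y x" using R(1) xy(4) by (blast dest: sympD)
  have "\<not> R x x" "\<not> R y y" using R(2) by (auto simp: irreflp_def)
  define ws where "ws = sort_key ?r (sorted_list_of_set ?W)"
  have ws: "set ws = ?W" "distinct ws" by (simp_all add: ws_def)
  have "card ?W = p" using xy n by (simp add: card_Diff_subset)
  then have len: "length ws = p" using ws distinct_card by metis
  define ds where "ds = map ?r ws"
  have ds: "sorted ds" "distinct ds" "set ds = ?r ` ?W" "length ds = p"
    using inj ws len by (simp_all add: ds_def ws_def distinct_map)
  define X where "X z = map (\<lambda>v. of_bool (R z v) :: nat) ws" for z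
  have lenX: "length (X z) = p" for z by (simp add: X_def len)
  have sum_ws: "sum_list (map f ws) = (\<Sum>v\<in>?W. f v)" for f :: "nat \<Rightarrow> nat"
    using ws by (simp add: sum_list_distinct_conv_sum_set)
  have sumX: "?r z = sum_list (X z) + 1" if "z \<in> {x, y}" for z
  proof -
    have "(\<Sum>u\<in>?W. of_bool (R u z) :: nat) = (\<Sum>u\<in>?W. of_bool (R z u))"
      using R(1) by (intro sum.cong refl arg_cong[where f = of_bool]) (blast dest: sympD)
    then show ?thesis
      using that xy \<open>R y x\<close> \<open>\<not> R x x\<close> \<open>\<not> R y y\<close>
      unfolding rdeg_eq_sum sum_lessThan_split_pair[OF xy(1-3)] X_def sum_ws by auto
  qed
  have fits: "fits ds (X z)" if "z \<in> {x, y}" for z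
  proof -
    have "?r v \<noteq> sum_list (X z) + 1 + of_bool (R z v)" if "v \<in> set ws" for v
      using z[OF \<open>z \<in> {x, y}\<close>] that sumX[OF \<open>z \<in> {x, y}\<close>] ws(1) by metis
    then show ?thesis
      unfolding fits_def ds_def X_def list.rel_map list_all2_same by blast
  qed
  have n_lists: "X z \<in> set (List.n_lists p [0, 1])" for z
    unfolding set_n_lists using len by (auto simp: X_def)
  have rW: "?r v = (\<Sum>u\<in>?W. of_bool (R u v)) + of_bool (R x v) + of_bool (R y v)" for v
    unfolding rdeg_eq_sum sum_lessThan_split_pair[OF xy(1-3)] ..
  have gain: "excess t s ds \<le> gain t s (X x) + gain t s (X y)" if "t + s \<le> p" for t s
  proof -
    let ?T = "set (drop (p - t) ws)" and ?B = "set (take s ws)"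
    have dist: "distinct (drop (p - t) ws)" "distinct (take s ws)" using ws by simp_all
    have card: "card ?T = t" "card ?B = s"
      using dist that len by (simp_all add: distinct_card)
    have sub: "?T \<subseteq> ?W" "?B \<subseteq> ?W" using ws(1) set_drop_subset set_take_subset by fast+
    have "?B \<inter> ?T = {}" using ws(2) that by (intro set_take_disj_set_drop_if_distinct) auto
    then have disj: "?T \<inter> ?B = {}" by blast
    have T: "sum_list (drop (p - t) (map f ws)) = (\<Sum>v\<in>?T. f v)" for f :: "nat \<Rightarrow> nat"
      using dist by (simp add: drop_map sum_list_distinct_conv_sum_set)
    have B: "sum_list (take s (map f ws)) = (\<Sum>v\<in>?B. f v)" for f :: "nat \<Rightarrow> nat"
      using dist by (simp add: take_map sum_list_distinct_conv_sum_set)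
    have "(\<Sum>v\<in>?T. \<Sum>u\<in>?W. of_bool (R u v) :: nat) \<le> (\<Sum>v\<in>?B. \<Sum>u\<in>?W. of_bool (R u v)) +
        (t * (t - 1) + t * (p - t - s))"
      using sum_degrees_top_le_bottom[OF R _ sub disj] card \<open>card ?W = p\<close> by simp
    moreover have split: "(\<Sum>v\<in>S. ?r v) = (\<Sum>v\<in>S. \<Sum>u\<in>?W. of_bool (R u v)) +
        (\<Sum>v\<in>S. of_bool (R x v)) + (\<Sum>v\<in>S. of_bool (R y v))" for S
      by (subst rW) (simp only: sum.distrib)
    ultimately have "(\<Sum>v\<in>?T. ?r v) + (\<Sum>v\<in>?B. of_bool (R x v)) + (\<Sum>v\<in>?B. of_bool (R y v)) \<le>
        (\<Sum>v\<in>?B. ?r v) + (\<Sum>v\<in>?T. of_bool (R x v)) + (\<Sum>v\<in>?T. of_bool (R y v)) +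
        (t * (t - 1) + t * (p - t - s))"
      unfolding split by linarith
    then show ?thesis
      unfolding excess_def gain_def lenX ds(4) unfolding X_def ds_def T B by linarith
  qed
  have even: "even (sum_list ds + sum_list (X x) + sum_list (X y))"
  proof -
    have "even (\<Sum>v<n. ?r v)"
      unfolding rdeg_eq_sum using R by (intro even_sum_degrees) auto
    also have "(\<Sum>v<n. ?r v) = sum_list ds + ?r x + ?r y"
      unfolding sum_lessThan_split_pair[OF xy(1-3)] ds_def sum_ws ..
    \<comment> \<open>The edge \<open>xy\<close> adds one to each of the two degrees, which leaves
      the parity unchanged.\<close>
    finally show ?thesis by (simp add: sumX)
  qed
  have "obstructed t s t' s' ds"
  proof -
    have "set ds \<subseteq> {0..<n}"
    proof
      fix d assume "d \<in> set ds"
      then obtain v where "v < n" "d = ?r v" unfolding ds(3) by blast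
      then show "d \<in> {0..<n}" using rdeg_complement(2)[OF R(2) \<open>v < n\<close>] by simp
    qed
    moreover have "\<not> (0 \<in> set ds \<and> n - 1 \<in> set ds)"
    proof
      assume "0 \<in> set ds \<and> n - 1 \<in> set ds"
      then obtain u v where "u < n" "v < n" "?r u = 0" "?r v = n - 1"
        unfolding ds(3) by (metis (no_types, lifting) DiffD1 imageE lessThan_iff)
      then show False using not_isolated_and_universal[OF R] n by fastforce
    qed
    moreover have "{0..<n} - {n - 1} = {0..<Suc p}" "{0..<n} - {0} = {1..<Suc (Suc p)}"
      using n by auto
    ultimately have "set ds \<subseteq> {0..<Suc p} \<or> set ds \<subseteq> {1..<Suc (Suc p)}"
      by blast
    moreover have "card (set ds) = p" using distinct_card[OF ds(2)] ds(4) by simp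
    ultimately consider k where "k < Suc p" "set ds = {0..<Suc p} - {k}"
      | k where "k < Suc p" "set ds = {1..<Suc (Suc p)} - {Suc k}"
    proof (elim disjE)
      assume "set ds \<subseteq> {0..<Suc p}"
      then obtain k where "k \<in> {0..<Suc p}" "set ds = {0..<Suc p} - {k}"
        using \<open>card (set ds) = p\<close> by (elim card_eq_imp_diff_singleton) simp_all
      then show thesis using that(1)[of k] by simp
    next
      assume "set ds \<subseteq> {1..<Suc (Suc p)}"
      then obtain k where "k \<in> {1..<Suc (Suc p)}" "set ds = {1..<Suc (Suc p)} - {k}"
        using \<open>card (set ds) = p\<close> by (elim card_eq_imp_diff_singleton) simp_all
      \<comment> \<open>The missing degree is written \<open>Suc k\<close> in the second family,
        hence the shift.\<close>
      then show thesis using that(2)[of "k - 1"] by (cases k) auto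
    qed
    then show ?thesis
    proof cases
      case 1
      have "ds = filter (\<lambda>i. i \<noteq> k) [0..<Suc p]" using ds 1(2) by (intro strict_sorted_eqI)
      moreover have "k \<in> set [0..<Suc p]" using 1(1) by (simp del: upt_Suc)
      ultimately show ?thesis using obs unfolding all_obstructed_def by blast
    next
      case 2
      have "ds = filter (\<lambda>i. i \<noteq> Suc k) [1..<Suc (Suc p)]" using ds 2(2) by (intro strict_sorted_eqI)
      moreover have "k \<in> set [0..<Suc p]" using 2(1) by (simp del: upt_Suc)
      ultimately show ?thesis using obs unfolding all_obstructed_def by blast
    qed
  qed
  then have "odd (sum_list ds + sum_list (X x) + sum_list (X y))"
  proof (rule obstructedD)
    show "sum_list (X x) < sum_list (X y)" using less by (simp add: sumX)
  qed (use n_lists fits gain ts ds(4) in auto)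
  then show False using even by blast
qed

section \<open>The lower bounds\<close>

text \<open>Without doubled edges the red degrees would be an injective, hence surjective, map of
  \<open>{..<n}\<close> to itself, giving an isolated and a universal vertex.\<close>

lemma lir_coloring_doubles_edge:
  assumes L: "lir_coloring n Ed R" and n: "2 \<le> n"
  shows "Ed \<noteq> {}"
proof
  assume Ed: "Ed = {}"
  obtain R where R: "symp R" "irreflp R" and L: "lir_coloring n Ed R"
    using lir_coloring_normalize[OF L] by metis
  let ?r = "rdeg n R"
  have red: "cdeg n Ed R v = ?r v" for v
  proof -
    have "{u. u < n \<and> u \<noteq> v \<and> R u v} = {u. u < n \<and> R u v}"
      using R(2) by (auto simp: irreflp_def)
    then show ?thesis by (simp add: cdeg_def rdeg_def Ed)
  qed
  have blue: "cdeg n Ed (\<lambda>u v. \<not> R u v) v = n - 1 - ?r v" if "v < n" for v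
    using rdeg_complement(1)[OF R(2) that] by (simp add: cdeg_def Ed)
  have "?r u \<noteq> ?r v" if "u < n" "v < n" "u \<noteq> v" for u v
  proof -
    have "if R u v then cdeg n Ed R u \<noteq> cdeg n Ed R v
        else cdeg n Ed (\<lambda>u v. \<not> R u v) u \<noteq> cdeg n Ed (\<lambda>u v. \<not> R u v) v"
      using L that unfolding lir_coloring_def by blast
    then show ?thesis
      unfolding red blue[OF that(1)] blue[OF that(2)] by (auto split: if_splits)
  qed
  then have "inj_on ?r {..<n}" by (intro inj_onI) blast
  moreover have "?r ` {..<n} \<subseteq> {..<n}"
  proof (rule image_subsetI)
    fix v assume "v \<in> {..<n}"
    then show "?r v \<in> {..<n}" using rdeg_complement(2)[OF R(2), of v n] n by simp
  qed
  ultimately have "?r ` {..<n} = {..<n}" by (intro endo_inj_surj) simp_all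
  then have "0 \<in> ?r ` {..<n}" "n - 1 \<in> ?r ` {..<n}" using n by auto
  then obtain u v where uv: "u < n" "0 = ?r u" "v < n" "n - 1 = ?r v"
    unfolding image_iff Bex_def lessThan_iff by blast
  then have "n = 1"
    by (intro not_isolated_and_universal[OF R uv(1,3) uv(2)[symmetric] uv(4)[symmetric]])
  then show False using n by simp
qed

text \<open>The two inequalities that suffice compare the upper half with the lower half, and once more
  with the upper half reduced by one vertex (\<open>p\<close> even) or the lower half enlarged by the middle
  vertex (\<open>p\<close> odd).\<close>

lemma all_obstructed_4: "all_obstructed 4 2 2 1 2" by code_simp
lemma all_obstructed_5: "all_obstructed 5 2 2 2 3" by code_simp
lemma all_obstructed_6: "all_obstructed 6 3 3 2 3" by code_simp
lemma all_obstructed_7: "all_obstructed 7 3 3 3 4" by code_simp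
lemma all_obstructed_8: "all_obstructed 8 4 4 3 4" by code_simp

lemma good_pair_commute: "good_pair n R x y \<Longrightarrow> good_pair n R y x"
  unfolding good_pair_def by (simp add: insert_commute) (blast dest: sympD)

lemma no_good_pair:
  assumes "6 \<le> n" "n \<le> 10"
  shows "\<not> good_pair n R x y"
proof -
  \<comment> \<open>The finite check assumes that \<open>x\<close> has the smaller degree;
    exchanging \<open>x\<close> and \<open>y\<close> covers the other order.\<close>
  have less: False if "good_pair n R x y" "rdeg n R x < rdeg n R y" for x y
  proof -
    consider "n = 4 + 2" | "n = 5 + 2" | "n = 6 + 2" | "n = 7 + 2" | "n = 8 + 2"
      using assms by linarith
    then show False
    proof cases
      case 1
      show False by (rule no_good_pair_if_all_obstructed[OF all_obstructed_4 _ _ 1 that]) simp_all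
    next
      case 2
      show False by (rule no_good_pair_if_all_obstructed[OF all_obstructed_5 _ _ 2 that]) simp_all
    next
      case 3
      show False by (rule no_good_pair_if_all_obstructed[OF all_obstructed_6 _ _ 3 that]) simp_all
    next
      case 4
      show False by (rule no_good_pair_if_all_obstructed[OF all_obstructed_7 _ _ 4 that]) simp_all
    next
      case 5
      show False by (rule no_good_pair_if_all_obstructed[OF all_obstructed_8 _ _ 5 that]) simp_all
    qed
  qed
  show ?thesis
  proof
    assume G: "good_pair n R x y"
    then have "rdeg n R x \<noteq> rdeg n R y" by (simp add: good_pair_def)
    then show False using less G good_pair_commute[OF G] by (metis linorder_neqE_nat)
  qed
qed

subsection \<open>The value for complete graphs\<close>

lemma edge_iff: "e \<in> gedges (complete_graph n) \<longleftrightarrow> (\<exists>x y. e = {x, y} \<and> x < n \<and> y < n \<and> x \<noteq> y)"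
  by (auto simp: complete_graph_def)

lemma finite_edges: "finite (gedges (complete_graph n))"
  by (rule finite_subset[of _ "Pow {..<n}"]) (auto simp: complete_graph_def)

lemma D_lir_complete_le:
  assumes "Ed \<subseteq> gedges (complete_graph n)" "lir_coloring n Ed R"
  shows "D_lir (complete_graph n) \<le> enat (card Ed)"
  unfolding D_lir_def using assms two_lir_colorable_double_complete_iff[OF assms(1)]
  by (intro INF_lower) blast

lemma D_lir_complete_ge:
  assumes "\<And>Ed R. Ed \<subseteq> gedges (complete_graph n) \<Longrightarrow> lir_coloring n Ed R \<Longrightarrow> k \<le> card Ed"
  shows "enat k \<le> D_lir (complete_graph n)"
  unfolding D_lir_def
proof (rule INF_greatest)
  fix Ed assume "Ed \<in> {Ed. Ed \<subseteq> gedges (complete_graph n) \<and> two_lir_colorable (double_edges (complete_graph n) Ed)}"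
  then show "enat k \<le> enat (card Ed)"
    using assms two_lir_colorable_double_complete_iff by auto
qed

lemma ex_lir_coloring_single:
  assumes "n = 4 \<or> n = 5 \<or> 11 \<le> n"
  shows "\<exists>x y R. x < n \<and> y < n \<and> x \<noteq> y \<and> lir_coloring n {{x, y}} R"
  using assms
proof (elim disjE)
  assume n: "n = 4"
  show ?thesis using lir_coloring_4 unfolding n by (intro exI[of _ 2] exI[of _ 3]) auto
next
  assume n: "n = 5"
  show ?thesis using lir_coloring_5 unfolding n by (intro exI[of _ 3] exI[of _ 4]) auto
next
  assume n: "11 \<le> n"
  have graph: "symp graph_11" "irreflp graph_11" "graph_11 9 10"
    by (auto simp: graph_11_def graph_of_def symp_def irreflp_def)
  have G: "good_pair 11 graph_11 9 10"
    using lir_coloring_11 lir_coloring_single_iff[OF graph(1,2) _ _ _ graph(3), of 11] by simp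
  have pos: "0 < rdeg 11 graph_11 v" if "v < 11" for v
  proof -
    have "rdeg 11 graph_11 v \<in> set (map (rdeg 11 graph_11) [0..<11])" using that by simp
    then show ?thesis unfolding rdeg_graph_11 by auto
  qed
  have "rdeg 11 graph_11 v = map (rdeg 11 graph_11) [0..<11] ! v" if "v < 11" for v
    using that by simp
  from this[of 9] this[of 10] have "rdeg 11 graph_11 9 = 4" "rdeg 11 graph_11 10 = 5"
    unfolding rdeg_graph_11 by simp_all
  then obtain R where R: "good_pair n R 9 10"
    using good_pair_extend_all[OF G _ _ _ n] pos by auto
  then have "lir_coloring n {{9, 10}} R"
    using lir_coloring_single_iff unfolding good_pair_def by blast
  then show ?thesis using n by (intro exI[of _ 9] exI[of _ 10]) auto
qed

lemma ex_lir_coloring_two: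
  assumes "6 \<le> n" "n \<le> 10"
  shows "\<exists>e f R. {e, f} \<subseteq> gedges (complete_graph n) \<and> e \<noteq> f \<and> lir_coloring n {e, f} R"
proof -
  have I: "\<exists>e f R. {e, f} \<subseteq> gedges (complete_graph n) \<and> e \<noteq> f \<and> lir_coloring n {e, f} R"
    if "lir_coloring n {{a, b}, {c, d}} R" "a < n" "b < n" "c < n" "d < n" "a \<noteq> b" "c \<noteq> d"
      "a \<noteq> c" "a \<noteq> d" for n a b c d R
  proof -
    have "{{a, b}, {c, d}} \<subseteq> gedges (complete_graph n)" using that by (auto simp: edge_iff)
    moreover have "{a, b} \<noteq> {c, d}" using that by (auto simp: doubleton_eq_iff)
    ultimately show ?thesis using that(1) by blast
  qed
  consider "n = 6" | "n = 7" | "n = 8" | "n = 9" | "n = 10" using assms by linarith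
  then show ?thesis
  proof cases
    case 1 show ?thesis unfolding 1 by (rule I[OF lir_coloring_6]) simp_all
  next
    case 2 show ?thesis unfolding 2 by (rule I[OF lir_coloring_7]) simp_all
  next
    case 3 show ?thesis unfolding 3 by (rule I[OF lir_coloring_8]) simp_all
  next
    case 4 show ?thesis unfolding 4 by (rule I[OF lir_coloring_9]) simp_all
  next
    case 5 show ?thesis unfolding 5 by (rule I[OF lir_coloring_10]) simp_all
  qed
qed

theorem mainTheorem8:
  fixes n :: nat
  assumes "n \<ge> 4"
  shows "D_lir (complete_graph n) = (if 6 \<le> n \<and> n \<le> 10 then 2 else 1)"
proof -
  have card_pos: "1 \<le> card Ed"
    if "Ed \<subseteq> gedges (complete_graph n)" "lir_coloring n Ed R" for Ed R
  proof -
    have "Ed \<noteq> {}" using lir_coloring_doubles_edge[OF that(2)] assms by linarith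
    \<comment> \<open>An infinite set would have \<open>card\<close> equal to 0.\<close>
    moreover have "finite Ed" using that(1) finite_edges by (rule finite_subset)
    ultimately show ?thesis by (simp add: Suc_le_eq card_gt_0_iff)
  qed
  show ?thesis
  proof (cases "6 \<le> n \<and> n \<le> 10")
    case True
    have "2 \<le> card Ed" if Ed: "Ed \<subseteq> gedges (complete_graph n)" "lir_coloring n Ed R" for Ed R
    proof (rule ccontr)
      assume "\<not> 2 \<le> card Ed"
      then have "card Ed = 1" using card_pos[OF Ed] by linarith
      then obtain x y where "Ed = {{x, y}}" "x < n" "y < n" "x \<noteq> y"
        using Ed(1) by (auto simp: card_1_singleton_iff edge_iff)
      then show False
        using good_pair_if_lir_coloring Ed(2) no_good_pair True by blast
    qed
    then have "enat 2 \<le> D_lir (complete_graph n)" by (rule D_lir_complete_ge)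
    moreover obtain e f R where "{e, f} \<subseteq> gedges (complete_graph n)" "e \<noteq> f" "lir_coloring n {e, f} R"
      using ex_lir_coloring_two True by blast
    then have "D_lir (complete_graph n) \<le> enat 2"
      using D_lir_complete_le[of "{e, f}" n R] by (simp add: numeral_2_eq_2)
    ultimately have "D_lir (complete_graph n) = enat 2" by (intro antisym)
    then show ?thesis unfolding enat_numeral if_P[OF True] .
  next
    case False
    have "enat 1 \<le> D_lir (complete_graph n)" using card_pos by (rule D_lir_complete_ge)
    moreover obtain x y R where "x < n" "y < n" "x \<noteq> y" "lir_coloring n {{x, y}} R"
    proof -
      have "n = 4 \<or> n = 5 \<or> 11 \<le> n" using False assms by linarith
      then show thesis using ex_lir_coloring_single that by blast
    qed
    then have "D_lir (complete_graph n) \<le> enat 1"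
      using D_lir_complete_le[of "{{x, y}}" n R] edge_iff[of "{x, y}" n] by auto
    ultimately have "D_lir (complete_graph n) = enat 1" by (intro antisym)
    then show ?thesis unfolding if_not_P[OF False] one_enat_def .
  qed
qed

end
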